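(* Let $M<N$ be positive integers, let $\mathbf{A}\in\mathbb{C}^{M\times N}$ and $\mathbf{y}\in\mathbb{C}^M$ with $\mathbf{y}\neq\mathbf{0}$, and assume that the system $\mathbf{y}=\mathbf{A}\mathbf{x}$ has at least one solution. Then there exists a constant $c\geq 1$, depending only on $\mathbf{y}$ and $\mathbf{A}$, such that every $\mathbf{x}\in\mathbb{C}^N$ with $\mathbf{y}=\mathbf{A}\mathbf{x}$ satisfies $$\mathit{PAR}(\mathbf{x})\,\mathit{PINC}(\mathbf{x})\geq c.$$ Furthermore, any solution $\hat{\mathbf{x}}^\infty$ of the $\ell^\infty$-norm minimization problem $$\min_{\tilde{\mathbf{x}}\in\mathbb{C}^N}\|\tilde{\mathbf{x}}\|_\infty\quad\text{subject to } \mathbf{y}=\mathbf{A}\tilde{\mathbf{x}}$$ achieves this lower bound with equality, i.e., $\mathit{PAR}(\hat{\mathbf{x}}^\infty)\,\mathit{PINC}(\hat{\mathbf{x}}^\infty)=c$, so that $\hat{\mathbf{x}}^\infty$ determines the constant $c$.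
   Context: For a nonzero vector $\mathbf{x}\in\mathbb{C}^N$, the peak-to-average-power ratio is $\mathit{PAR}(\mathbf{x})=\dfrac{N\|\mathbf{x}\|_\infty^2}{\|\mathbf{x}\|_2^2}$. Given $\mathbf{A}\in\mathbb{C}^{M\times N}$ and $\mathbf{y}\in\mathbb{C}^M$, the least-squares (LS) solution $\hat{\mathbf{x}}^{\mathrm{LS}}$ is the minimizer of $\|\tilde{\mathbf{x}}\|_2$ over all $\tilde{\mathbf{x}}\in\mathbb{C}^N$ with $\mathbf{y}=\mathbf{A}\tilde{\mathbf{x}}$. For any $\mathbf{x}$ with $\mathbf{y}=\mathbf{A}\mathbf{x}$, the power increase is $\mathit{PINC}(\mathbf{x})=\dfrac{\|\mathbf{x}\|_2^2}{\|\hat{\mathbf{x}}^{\mathrm{LS}}\|_2^2}$. The norms are $\|\mathbf{x}\|_2=(\sum_k|x_k|^2)^{1/2}$ and $\|\mathbf{x}\|_\infty=\max_k|x_k|$. *)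

theory Defs
  imports "HOL-Analysis.Analysis"
begin

(* The library's "norm" on complex ^ 'n is the l2 norm (lemma norm_eq_sqrt_sum below).
   Its "infnorm" is not the l-infinity norm on complex ^ 'n: it takes the maximum of
   absolute real and imaginary parts. Hence the separate definition. *)
definition linf_norm :: "complex ^ 'n \<Rightarrow> real" where
  "linf_norm x = Max (range (\<lambda>k. cmod (x $ k)))"

lemma norm_eq_sqrt_sum:
  fixes x :: "complex ^ 'n"
  shows "norm x = sqrt (\<Sum>k\<in>UNIV. (cmod (x $ k))\<^sup>2)"
  by (simp add: norm_vec_def L2_set_def)

definition PAR :: "complex ^ 'n \<Rightarrow> real" where
  "PAR x = real CARD('n) * (linf_norm x)\<^sup>2 / (norm x)\<^sup>2"

definition LS_solution :: "complex ^ 'n ^ 'm \<Rightarrow> complex ^ 'm \<Rightarrow> complex ^ 'n" where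
  "LS_solution A y = (THE x. is_arg_min norm (\<lambda>x. y = A *v x) x)"

lemma ex1_LS_solution:
  fixes A :: "complex ^ 'n ^ 'm"
  assumes "\<exists>x. y = A *v x"
  shows "\<exists>!x. is_arg_min norm (\<lambda>x. y = A *v x) x"
proof -
  let ?S = "{x. y = A *v x}"
  have cont: "continuous_on UNIV (\<lambda>x. A *v x)"
    by (simp add: matrix_vector_mult_def) (intro continuous_intros)
  have clo: "closed ?S"
    using cont by (intro closed_Collect_eq continuous_intros)
  have scale: "A *v (u *\<^sub>R x) = u *\<^sub>R (A *v x)" for u x
    by (simp add: vec_eq_iff matrix_vector_mult_def scaleR_sum_right)
  have conv: "convex ?S"
  proof (rule convexI)
    fix u v :: real and a b assume H: "a \<in> ?S" "b \<in> ?S" "u + v = 1"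
    have "A *v (u *\<^sub>R a + v *\<^sub>R b) = u *\<^sub>R (A *v a) + v *\<^sub>R (A *v b)"
      by (simp only: matrix_vector_right_distrib scale)
    also have "\<dots> = u *\<^sub>R y + v *\<^sub>R y"
      using H(1,2) by simp
    also have "\<dots> = y"
      using H(3) by (metis scaleR_left_distrib scaleR_one)
    finally show "u *\<^sub>R a + v *\<^sub>R b \<in> ?S"
      by simp
  qed
  have argmin_iff: "is_arg_min norm (\<lambda>x. y = A *v x) z \<longleftrightarrow>
      z \<in> ?S \<and> (\<forall>x\<in>?S. dist 0 z \<le> dist 0 x)" for z
    unfolding is_arg_min_def dist_0_norm by (simp add: not_less)
  have ne: "?S \<noteq> {}"
    using assms by simp
  obtain z where z: "z \<in> ?S" "\<forall>x\<in>?S. dist 0 z \<le> dist 0 x"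
    by (rule distance_attains_inf[OF clo ne, of 0]) blast
  show ?thesis
    unfolding argmin_iff
  proof (intro ex1I conjI)
    show "z \<in> ?S" "\<forall>x\<in>?S. dist 0 z \<le> dist 0 x"
      by (fact z)+
    fix w assume w: "w \<in> ?S \<and> (\<forall>x\<in>?S. dist 0 w \<le> dist 0 x)"
    show "w = z"
      by (rule any_closest_point_unique[OF conv clo conjunct1[OF w] z(1) conjunct2[OF w] z(2)])
  qed
qed

definition PINC :: "complex ^ 'n ^ 'm \<Rightarrow> complex ^ 'm \<Rightarrow> complex ^ 'n \<Rightarrow> real" where
  "PINC A y x = (norm x)\<^sup>2 / (norm (LS_solution A y))\<^sup>2"

end

(* The factor norm x cancels in PAR x * PINC A y x, leaving N times the square of the quotient of
   the l-infinity norm of x by the l2 norm of the least-squares solution. The second norm does not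
   depend on x, so the product is minimal exactly where the l-infinity norm is, and c is its infimum.
   It is at least 1 because N times the squared l-infinity norm bounds the squared l2 norm, and the
   least-squares solution has minimal l2 norm. *)

theory Submission
  imports Defs
begin

lemma cmod_nth_le_linf_norm: "cmod (x $ k) \<le> linf_norm x"
  unfolding linf_norm_def by (intro Max_ge) auto

lemma linf_norm_nonneg: "0 \<le> linf_norm x"
  using cmod_nth_le_linf_norm norm_ge_zero order_trans by blast

lemma norm_squared_le_linf_norm:
  fixes x :: "complex ^ 'n"
  shows "(norm x)\<^sup>2 \<le> real CARD('n) * (linf_norm x)\<^sup>2"
proof -
  have "(norm x)\<^sup>2 = (\<Sum>k\<in>UNIV. (cmod (x $ k))\<^sup>2)"
    by (simp add: norm_eq_sqrt_sum sum_nonneg)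
  also have "\<dots> \<le> real CARD('n) * (linf_norm x)\<^sup>2"
    by (intro sum_bounded_above power_mono cmod_nth_le_linf_norm norm_ge_zero)
  finally show ?thesis .
qed

lemma is_arg_min_LS_solution:
  assumes "\<exists>x. y = A *v x"
  shows "is_arg_min norm (\<lambda>x. y = A *v x) (LS_solution A y)"
  unfolding LS_solution_def by (rule theI'[OF ex1_LS_solution[OF assms]])

lemma PAR_PINC_eq:
  fixes x :: "complex ^ 'n"
  assumes "x \<noteq> 0"
  shows "PAR x * PINC A y x = real CARD('n) * (linf_norm x)\<^sup>2 / (norm (LS_solution A y))\<^sup>2"
  using assms by (simp add: PAR_def PINC_def)

text \<open>Serves twice in \<open>lemma1\<close>: it makes the set of products bounded below, so
  that its infimum is meaningful, and it bounds that infimum by 1.\<close>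

lemma PAR_PINC_ge_1:
  fixes A :: "complex ^ 'n ^ 'm"
  assumes "y \<noteq> 0" and x: "y = A *v x"
  shows "1 \<le> PAR x * PINC A y x"
proof -
  have LS: "is_arg_min norm (\<lambda>x. y = A *v x) (LS_solution A y)"
    using x by (intro is_arg_min_LS_solution exI)
  \<comment> \<open>Both vectors solve the system, and 0 does not since \<open>y \<noteq> 0\<close>.
    A zero denominator would make the quotient 0 and break the bound.\<close>
  have ne: "LS_solution A y \<noteq> 0" "x \<noteq> 0"
    using LS assms by (auto simp: is_arg_min_def)
  have "norm (LS_solution A y) \<le> norm x"
    using LS x by (auto simp: is_arg_min_def not_less)
  then have "(norm (LS_solution A y))\<^sup>2 \<le> (norm x)\<^sup>2"
    by (simp add: power_mono)
  also have "\<dots> \<le> real CARD('n) * (linf_norm x)\<^sup>2"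
    by (rule norm_squared_le_linf_norm)
  finally show ?thesis
    using ne by (simp add: PAR_PINC_eq)
qed

theorem lemma1:
  fixes A :: "complex ^ 'n ^ 'm" and y :: "complex ^ 'm"
  assumes "CARD('m) < CARD('n)"
    and "y \<noteq> 0"
    and "\<exists>x. y = A *v x"
  shows "\<exists>c\<ge>1. (\<forall>x. y = A *v x \<longrightarrow> PAR x * PINC A y x \<ge> c) \<and>
                (\<forall>xinf. is_arg_min linf_norm (\<lambda>x. y = A *v x) xinf \<longrightarrow>
                        PAR xinf * PINC A y xinf = c)"
proof -
  define S where "S = {x. y = A *v x}"
  define f where "f x = PAR x * PINC A y x" for x
  have bdd: "bdd_below (f ` S)"
    using PAR_PINC_ge_1[OF assms(2)] by (intro bdd_belowI2[of _ 1]) (auto simp: S_def f_def)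
  \<comment> \<open>Solvability makes \<open>S\<close> nonempty, so the common lower bound 1 passes
    to the infimum.\<close>
  have "1 \<le> Inf (f ` S)"
    using PAR_PINC_ge_1[OF assms(2)] assms(3)
    by (intro cINF_greatest) (auto simp: S_def f_def)
  moreover have "Inf (f ` S) \<le> f x" if "y = A *v x" for x
    using that by (intro cINF_lower bdd) (simp add: S_def)
  moreover have "f z = Inf (f ` S)" if z: "is_arg_min linf_norm (\<lambda>x. y = A *v x) z" for z
  proof -
    have zS: "z \<in> S"
      using z by (simp add: is_arg_min_def S_def)
    have "f z \<le> f x" if "x \<in> S" for x
    proof -
      \<comment> \<open>Nonzero vectors allow \<open>PAR_PINC_eq\<close> on both sides; the two
        quotients then share their denominator and compare by \<open>linf_norm\<close>
        alone.\<close>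
      have "x \<noteq> 0" "z \<noteq> 0"
        using assms(2) that zS by (auto simp: S_def)
      moreover have "linf_norm z \<le> linf_norm x"
        using z that by (auto simp: is_arg_min_def S_def not_less)
      ultimately show ?thesis
        by (simp add: f_def PAR_PINC_eq divide_right_mono mult_left_mono power_mono linf_norm_nonneg)
    qed
    with zS have "Inf (f ` S) = f z"
      by (intro cInf_eq_minimum) auto
    then show ?thesis ..
  qed
  ultimately show ?thesis
    unfolding f_def by blast
qed

end
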